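(* Let $m\ge 2$ and let $G$ be a finite group with center $Z(G)$ such that $G/Z(G)\cong D_{2m}$. Then $$\text{L-Spec}(\Gamma_G) = \{0^{m+1},\ ((m-1)|Z(G)|)^{(m-1)|Z(G)|-1},\ (|Z(G)|)^{m(|Z(G)|-1)}\}$$ and $$\text{Q-Spec}(\Gamma_G) = \{(2(m-1)|Z(G)|-2)^1,\ ((m-1)|Z(G)|-2)^{(m-1)|Z(G)|-1},\ (2|Z(G)|-2)^m,\ (|Z(G)|-2)^{m(|Z(G)|-1)}\}.$$
   Context: $D_{2m}=\langle a,b : a^m=b^2=1,\ bab^{-1}=a^{-1}\rangle$ is the dihedral group of order $2m$ (for $m=2$ it is $\mathbb{Z}_2\times\mathbb{Z}_2$). The commuting graph $\Gamma_G$ of a finite non-abelian group $G$ is the simple undirected graph with vertex set $G\setminus Z(G)$ in which two distinct vertices $x,y$ are adjacent if and only if $xy=yx$. For a finite graph $\mathcal{G}$ with adjacency matrix $A$ and (diagonal) degree matrix $D$, $\text{L-Spec}(\mathcal{G})$ and $\text{Q-Spec}(\mathcal{G})$ denote the multisets of eigenvalues (with multiplicity) of the Laplacian matrix $D-A$ and of the signless Laplacian matrix $D+A$, respectively. The notation $\{\alpha_1^{a_1},\dots,\alpha_l^{a_l}\}$ means the multiset in which $\alpha_i$ is listed $a_i$ times (if listed values coincide, their multiplicities add; an exponent $0$ means the value does not appear). *)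

theory Defs
  imports
    "HOL-Algebra.Coset"
    "Graph_Theory.Digraph_Component"
    "Jordan_Normal_Form.Char_Poly"
    "HOL-Computational_Algebra.Polynomial"
    Complex_Main
begin

section \<open>Groups given by generators and relations\<close>

text \<open>A word is a list of letters; the letter \<open>(g, True)\<close> stands for the generator
  \<open>g\<close> and \<open>(g, False)\<close> for its formal inverse. Taking classes of all such words modulo the
  congruence generated by free cancellation and the defining relations gives
  the quotient of the free group by the normal closure of the relations.\<close>

type_synonym 'g word = "('g \<times> bool) list"

inductive word_eq :: "('g word \<times> 'g word) set \<Rightarrow> 'g word \<Rightarrow> 'g word \<Rightarrow> bool"
  for R :: "('g word \<times> 'g word) set" where
  cancel: "word_eq R [(g, s), (g, \<not> s)] []"
| relation: "(u, v) \<in> R \<Longrightarrow> word_eq R u v"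
| refl: "word_eq R u u"
| sym: "word_eq R u v \<Longrightarrow> word_eq R v u"
| trans: "word_eq R u v \<Longrightarrow> word_eq R v w \<Longrightarrow> word_eq R u w"
| append: "word_eq R u u' \<Longrightarrow> word_eq R v v' \<Longrightarrow> word_eq R (u @ v) (u' @ v')"

definition presented_group :: "('g word \<times> 'g word) set \<Rightarrow> 'g word set monoid" where
  "presented_group R =
    \<lparr> carrier = UNIV // {(u, v). word_eq R u v},
      monoid.mult = (\<lambda>X Y. {w. \<exists>u\<in>X. \<exists>v\<in>Y. word_eq R (u @ v) w}),
      monoid.one = {w. word_eq R [] w} \<rparr>"

datatype dihedral_gen = Gen_a | Gen_b

definition dihedral_group :: "nat \<Rightarrow> dihedral_gen word set monoid" where
  "dihedral_group m = presented_group
    {(replicate m (Gen_a, True), []),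
     (replicate 2 (Gen_b, True), []),
     ([(Gen_b, True), (Gen_a, True), (Gen_b, False)], [(Gen_a, False)])}"


section \<open>The commuting graph\<close>

definition group_center :: "('a, 'b) monoid_scheme \<Rightarrow> 'a set" where
  "group_center G = {z \<in> carrier G. \<forall>x\<in>carrier G. z \<otimes>\<^bsub>G\<^esub> x = x \<otimes>\<^bsub>G\<^esub> z}"

text \<open>Undirected simple graphs are represented, as in \<open>Graph_Theory\<close>, as symmetric loop-free
  digraphs without multiple arcs (locale \<open>graph\<close>).\<close>

definition commuting_graph :: "('a, 'b) monoid_scheme \<Rightarrow> ('a, 'a \<times> 'a) pre_digraph" where
  "commuting_graph G =
    \<lparr> verts = carrier G - group_center G,
      arcs = {(x, y). x \<in> carrier G - group_center G \<and> y \<in> carrier G - group_center G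
                \<and> x \<noteq> y \<and> x \<otimes>\<^bsub>G\<^esub> y = y \<otimes>\<^bsub>G\<^esub> x},
      tail = fst, head = snd \<rparr>"

lemma graph_commuting_graph:
  assumes "finite (carrier G)"
  shows "graph (commuting_graph G)"
proof
  show "finite (arcs (commuting_graph G))"
    by (rule finite_subset[of _ "carrier G \<times> carrier G"])
       (use assms in \<open>auto simp: commuting_graph_def\<close>)
qed (use assms in \<open>auto simp: commuting_graph_def arc_to_ends_def symmetric_conv\<close>)


section \<open>Laplacian and signless Laplacian spectra\<close>

text \<open>Rows and columns are indexed through a list \<open>vs\<close> enumerating the vertices. In a symmetric
  digraph the degree of a vertex is its out-degree.\<close>

definition adjacency_matrix :: "('a, 'b) pre_digraph \<Rightarrow> 'a list \<Rightarrow> complex mat" where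
  "adjacency_matrix \<Gamma> vs =
    mat (length vs) (length vs) (\<lambda>(i, j). if vs ! i \<rightarrow>\<^bsub>\<Gamma>\<^esub> vs ! j then 1 else 0)"

definition degree_matrix :: "('a, 'b) pre_digraph \<Rightarrow> 'a list \<Rightarrow> complex mat" where
  "degree_matrix \<Gamma> vs =
    mat (length vs) (length vs) (\<lambda>(i, j). if i = j then of_nat (out_degree \<Gamma> (vs ! i)) else 0)"

definition laplacian_matrix :: "('a, 'b) pre_digraph \<Rightarrow> 'a list \<Rightarrow> complex mat" where
  "laplacian_matrix \<Gamma> vs = degree_matrix \<Gamma> vs - adjacency_matrix \<Gamma> vs"

definition signless_laplacian_matrix :: "('a, 'b) pre_digraph \<Rightarrow> 'a list \<Rightarrow> complex mat" where
  "signless_laplacian_matrix \<Gamma> vs = degree_matrix \<Gamma> vs + adjacency_matrix \<Gamma> vs"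

text \<open>Eigenvalues are counted with algebraic multiplicity; for the symmetric matrices used here
  this coincides with the geometric one.\<close>

definition eigenvalue_mset :: "complex mat \<Rightarrow> complex multiset" where
  "eigenvalue_mset A = proots (char_poly A)"

definition vertex_list :: "('a, 'b) pre_digraph \<Rightarrow> 'a list" where
  "vertex_list \<Gamma> = (SOME vs. distinct vs \<and> set vs = verts \<Gamma>)"

definition L_spec :: "('a, 'b) pre_digraph \<Rightarrow> complex multiset" where
  "L_spec \<Gamma> = eigenvalue_mset (laplacian_matrix \<Gamma> (vertex_list \<Gamma>))"

definition Q_spec :: "('a, 'b) pre_digraph \<Rightarrow> complex multiset" where
  "Q_spec \<Gamma> = eigenvalue_mset (signless_laplacian_matrix \<Gamma> (vertex_list \<Gamma>))"

text \<open>The spectra do not depend on the chosen enumeration of the vertices.\<close>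

lemma char_poly_reindex:
  fixes f :: "'a \<Rightarrow> 'a \<Rightarrow> 'c :: field"
  assumes "distinct us" "distinct vs" "set us = set vs"
  shows "char_poly (mat (length us) (length us) (\<lambda>(i, j). f (us ! i) (us ! j)))
       = char_poly (mat (length vs) (length vs) (\<lambda>(i, j). f (vs ! i) (vs ! j)))"
proof -
  define n where "n = length vs"
  have n: "length us = n"
    using assms distinct_card[of us] distinct_card[of vs] by (simp add: n_def)
  define P :: "'c mat" where "P = mat n n (\<lambda>(i, j). if us ! i = vs ! j then 1 else 0)"
  define Q :: "'c mat" where "Q = mat n n (\<lambda>(i, j). if vs ! i = us ! j then 1 else 0)"
  define A :: "'c mat" where "A = mat n n (\<lambda>(i, j). f (us ! i) (us ! j))"
  define B :: "'c mat" where "B = mat n n (\<lambda>(i, j). f (vs ! i) (vs ! j))"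
  have ex_us: "\<exists>k<n. us ! k = vs ! i" if "i < n" for i
    using that assms(3) n by (metis in_set_conv_nth n_def nth_mem)
  have ex_vs: "\<exists>k<n. vs ! k = us ! i" if "i < n" for i
    using that assms(3) n by (metis in_set_conv_nth n_def nth_mem)
  have sum_us: "(\<Sum>k = 0..<n. if us ! k = vs ! i then h (us ! k) else 0) = h (vs ! i)"
    if i: "i < n" for i and h :: "'a \<Rightarrow> 'c"
  proof -
    obtain k where k: "k < n" "us ! k = vs ! i" using ex_us[OF i] by blast
    have "(us ! j = vs ! i) = (j = k)" if "j < n" for j
      using that k assms(1) n nth_eq_iff_index_eq by metis
    then have "(\<Sum>j = 0..<n. if us ! j = vs ! i then h (us ! j) else 0)
        = (\<Sum>j = 0..<n. if j = k then h (us ! j) else 0)"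
      by (intro sum.cong) auto
    then show ?thesis using k by simp
  qed
  have sum_vs: "(\<Sum>k = 0..<n. if vs ! k = us ! i then h (vs ! k) else 0) = h (us ! i)"
    if i: "i < n" for i and h :: "'a \<Rightarrow> 'c"
  proof -
    obtain k where k: "k < n" "vs ! k = us ! i" using ex_vs[OF i] by blast
    have "(vs ! j = us ! i) = (j = k)" if "j < n" for j
      using that k assms(2) n_def nth_eq_iff_index_eq by metis
    then have "(\<Sum>j = 0..<n. if vs ! j = us ! i then h (vs ! j) else 0)
        = (\<Sum>j = 0..<n. if j = k then h (vs ! j) else 0)"
      by (intro sum.cong) auto
    then show ?thesis using k by simp
  qed
  have carr: "P \<in> carrier_mat n n" "Q \<in> carrier_mat n n" "A \<in> carrier_mat n n" "B \<in> carrier_mat n n"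
    by (auto simp: P_def Q_def A_def B_def)
  have PQ: "P * Q = 1\<^sub>m n"
  proof (rule eq_matI)
    fix i j assume "i < dim_row (1\<^sub>m n :: 'c mat)" "j < dim_col (1\<^sub>m n :: 'c mat)"
    then have ij: "i < n" "j < n" by auto
    have "(P * Q) $$ (i, j)
        = (\<Sum>k = 0..<n. if vs ! k = us ! i then (if vs ! k = us ! j then 1 else 0) else 0)"
      using ij by (auto simp: P_def Q_def scalar_prod_def intro!: sum.cong)
    also have "\<dots> = (if us ! i = us ! j then 1 else 0)"
      using sum_vs[of i "\<lambda>x. if x = us ! j then 1 else 0"] ij by simp
    finally show "(P * Q) $$ (i, j) = 1\<^sub>m n $$ (i, j)"
      using ij n assms(1) by (simp add: nth_eq_iff_index_eq)
  qed (auto simp: P_def Q_def)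
  have QP: "Q * P = 1\<^sub>m n"
    using mat_mult_left_right_inverse[OF carr(1,2) PQ] .
  have PB: "P * B = mat n n (\<lambda>(i, j). f (us ! i) (vs ! j))"
  proof (rule eq_matI)
    fix i j assume "i < dim_row (mat n n (\<lambda>(i, j). f (us ! i) (vs ! j)))"
      "j < dim_col (mat n n (\<lambda>(i, j). f (us ! i) (vs ! j)))"
    then have ij: "i < n" "j < n" by auto
    have "(P * B) $$ (i, j)
        = (\<Sum>k = 0..<n. if vs ! k = us ! i then f (vs ! k) (vs ! j) else 0)"
      using ij by (auto simp: P_def B_def scalar_prod_def intro!: sum.cong)
    also have "\<dots> = f (us ! i) (vs ! j)"
      using sum_vs[of i "\<lambda>x. f x (vs ! j)"] ij by simp
    finally show "(P * B) $$ (i, j) = mat n n (\<lambda>(i, j). f (us ! i) (vs ! j)) $$ (i, j)"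
      using ij by simp
  qed (auto simp: P_def B_def)
  have AP: "A * P = mat n n (\<lambda>(i, j). f (us ! i) (vs ! j))"
  proof (rule eq_matI)
    fix i j assume "i < dim_row (mat n n (\<lambda>(i, j). f (us ! i) (vs ! j)))"
      "j < dim_col (mat n n (\<lambda>(i, j). f (us ! i) (vs ! j)))"
    then have ij: "i < n" "j < n" by auto
    have "(A * P) $$ (i, j)
        = (\<Sum>k = 0..<n. if us ! k = vs ! j then f (us ! i) (us ! k) else 0)"
      using ij by (auto simp: P_def A_def scalar_prod_def intro!: sum.cong)
    also have "\<dots> = f (us ! i) (vs ! j)"
      using sum_us[of j "\<lambda>x. f (us ! i) x"] ij by simp
    finally show "(A * P) $$ (i, j) = mat n n (\<lambda>(i, j). f (us ! i) (vs ! j)) $$ (i, j)"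
      using ij by simp
  qed (auto simp: P_def A_def)
  have "A = A * (P * Q)" using carr PQ by simp
  also have "\<dots> = A * P * Q" using carr by (simp add: assoc_mult_mat[of _ n n _ n _ n])
  also have "\<dots> = P * B * Q" by (simp only: AP PB)
  finally have "similar_mat A B"
    unfolding similar_mat_def similar_mat_wit_def using PQ QP carr
    by (intro exI[of _ P] exI[of _ Q]) (auto simp: Let_def)
  then show ?thesis
    using char_poly_similar[of A B] n by (simp add: A_def B_def n_def)
qed

lemma
  assumes "finite (verts \<Gamma>)" and "distinct vs" and "set vs = verts \<Gamma>"
  shows L_spec_any_enumeration: "L_spec \<Gamma> = eigenvalue_mset (laplacian_matrix \<Gamma> vs)"
    and Q_spec_any_enumeration: "Q_spec \<Gamma> = eigenvalue_mset (signless_laplacian_matrix \<Gamma> vs)"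
proof -
  have "distinct (vertex_list \<Gamma>) \<and> set (vertex_list \<Gamma>) = verts \<Gamma>"
    unfolding vertex_list_def
    by (rule someI_ex) (use finite_distinct_list[OF assms(1)] in blast)
  then have us: "distinct (vertex_list \<Gamma>)" "set (vertex_list \<Gamma>) = set vs"
    using assms(3) by auto
  let ?D = "\<lambda>x y. if x = y then of_nat (out_degree \<Gamma> x) else (0::complex)"
  let ?A = "\<lambda>x y. if x \<rightarrow>\<^bsub>\<Gamma>\<^esub> y then 1 else (0::complex)"
  have L: "laplacian_matrix \<Gamma> ws
      = mat (length ws) (length ws) (\<lambda>(i, j). ?D (ws ! i) (ws ! j) - ?A (ws ! i) (ws ! j))"
    and Q: "signless_laplacian_matrix \<Gamma> ws
      = mat (length ws) (length ws) (\<lambda>(i, j). ?D (ws ! i) (ws ! j) + ?A (ws ! i) (ws ! j))"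
    if "distinct ws" for ws
    using that
    by (auto simp: laplacian_matrix_def signless_laplacian_matrix_def degree_matrix_def
        adjacency_matrix_def nth_eq_iff_index_eq intro!: eq_matI)
  show "L_spec \<Gamma> = eigenvalue_mset (laplacian_matrix \<Gamma> vs)"
    unfolding L_spec_def eigenvalue_mset_def L[OF us(1)] L[OF assms(2)]
    using char_poly_reindex[OF us(1) assms(2) us(2), of "\<lambda>x y. ?D x y - ?A x y"] by simp
  show "Q_spec \<Gamma> = eigenvalue_mset (signless_laplacian_matrix \<Gamma> vs)"
    unfolding Q_spec_def eigenvalue_mset_def Q[OF us(1)] Q[OF assms(2)]
    using char_poly_reindex[OF us(1) assms(2) us(2), of "\<lambda>x y. ?D x y + ?A x y"] by simp
qed

end

theory Submission
  imports Defs "HOL-Library.Disjoint_Sets" "HOL-Number_Theory.Cong"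
begin

text \<open>Let \<open>x, y\<close> lift the generators \<open>a, b\<close> of \<open>G/Z \<cong> D\<^sub>2\<^sub>m\<close>. The centraliser \<open>A\<close> of \<open>x\<close> is the union
  of the cosets \<open>Z x\<^sup>i\<close>; it is abelian of index two. A non-central element of \<open>A\<close> commutes
  exactly with \<open>A\<close>, and an element \<open>h\<close> outside \<open>A\<close> commutes, apart from \<open>Z\<close>, exactly with
  the coset \<open>Z h\<close>. Hence the commuting graph is the disjoint union of a clique \<open>A - Z\<close>
  on \<open>(m - 1) |Z|\<close> vertices and \<open>m\<close> cliques on \<open>|Z|\<close> vertices. On a clique both Laplacians
  are a scalar matrix plus a multiple of the all-ones matrix.\<close>

section \<open>Spectra of disjoint unions of cliques\<close>

text \<open>Subtracting a block diagonal matrix from the scalar matrix of the indeterminate leaves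
  it block diagonal, so the determinant splits.\<close>

lemma char_poly_block_diagonal:
  fixes A D :: "'c :: field mat"
  assumes A: "A \<in> carrier_mat n n" and D: "D \<in> carrier_mat k k"
  shows "char_poly (four_block_mat A (0\<^sub>m n k) (0\<^sub>m k n) D) = char_poly A * char_poly D"
proof -
  have "char_poly_matrix (four_block_mat A (0\<^sub>m n k) (0\<^sub>m k n) D)
      = four_block_mat (char_poly_matrix A) (0\<^sub>m n k) (0\<^sub>m k n) (char_poly_matrix D)"
    using A D by (intro eq_matI) (auto simp: char_poly_matrix_def)
  then show ?thesis
    unfolding char_poly_def
    by (simp add: det_four_block_mat_lower_left_zero[of _ n _ k] A D)
qed

text \<open>Entries depend on vertices rather than on positions, so that concatenating vertex lists
  corresponds to composing block matrices.\<close>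

definition list_mat :: "('a \<Rightarrow> 'a \<Rightarrow> 'c) \<Rightarrow> 'a list \<Rightarrow> 'c mat" where
  "list_mat f vs = mat (length vs) (length vs) (\<lambda>(i, j). f (vs ! i) (vs ! j))"

lemma list_mat_carrier [simp]: "list_mat f vs \<in> carrier_mat (length vs) (length vs)"
  by (simp add: list_mat_def)

lemma char_poly_list_mat_append:
  fixes f :: "'a \<Rightarrow> 'a \<Rightarrow> 'c :: field"
  assumes "\<And>x y. x \<in> set us \<Longrightarrow> y \<in> set vs \<Longrightarrow> f x y = 0 \<and> f y x = 0"
  shows "char_poly (list_mat f (us @ vs)) = char_poly (list_mat f us) * char_poly (list_mat f vs)"
proof -
  have "list_mat f (us @ vs) = four_block_mat (list_mat f us) (0\<^sub>m (length us) (length vs))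
          (0\<^sub>m (length vs) (length us)) (list_mat f vs)"
    using assms by (intro eq_matI) (auto simp: list_mat_def nth_append)
  then show ?thesis
    by (simp add: char_poly_block_diagonal)
qed

text \<open>Listing the vertices block by block makes the matrix block diagonal, and each induction
  step adds one diagonal block. A single suitable enumeration is enough, because the spectra do not
  depend on the enumeration. The value \<open>q C\<close> is required for every listing of
  \<open>C\<close>, since the induction picks an arbitrary one.\<close>

lemma char_poly_partition:
  fixes f :: "'a \<Rightarrow> 'a \<Rightarrow> 'c :: field"
  assumes "finite P" and "\<And>C. C \<in> P \<Longrightarrow> finite C" and "disjoint P"
    and "\<And>C x y. C \<in> P \<Longrightarrow> x \<in> C \<Longrightarrow> y \<in> \<Union>P - C \<Longrightarrow> f x y = 0 \<and> f y x = 0"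
    and "\<And>C ws. C \<in> P \<Longrightarrow> distinct ws \<Longrightarrow> set ws = C \<Longrightarrow> char_poly (list_mat f ws) = q C"
  shows "\<exists>vs. distinct vs \<and> set vs = \<Union>P \<and> char_poly (list_mat f vs) = (\<Prod>C\<in>P. q C)"
  using assms
proof (induction P rule: finite_induct)
  case empty
  have "char_poly (list_mat f []) = 1"
    by (simp add: list_mat_def char_poly_def char_poly_matrix_def det_dim_zero)
  then show ?case by simp
next
  case (insert C P)
  have dis: "C \<inter> \<Union>P = {}"
    using insert.prems(2) insert.hyps(2) by (auto simp: pairwise_insert disjnt_def)
  have "\<exists>vs. distinct vs \<and> set vs = \<Union>P \<and> char_poly (list_mat f vs) = (\<Prod>C\<in>P. q C)"
  proof (rule insert.IH)
    show "disjoint P" using insert.prems(2) by (simp add: pairwise_insert)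
    show "f x y = 0 \<and> f y x = 0" if "C' \<in> P" "x \<in> C'" "y \<in> \<Union>P - C'" for C' x y
      using insert.prems(3)[of C' x y] that by auto
  qed (use insert.prems in auto)
  then obtain vs where vs: "distinct vs" "set vs = \<Union>P"
      "char_poly (list_mat f vs) = (\<Prod>C\<in>P. q C)"
    by blast
  obtain us where us: "distinct us" "set us = C"
    using finite_distinct_list insert.prems(1) by blast
  have "f x y = 0 \<and> f y x = 0" if "x \<in> set us" "y \<in> set vs" for x y
    using insert.prems(3)[of C x y] that us vs dis by auto
  then have "char_poly (list_mat f (us @ vs)) = (\<Prod>C\<in>insert C P. q C)"
    using char_poly_list_mat_append[of us vs f] vs(3) insert.prems(4)[OF _ us] insert.hyps by simp
  then show ?case
    using us vs dis by (intro exI[of _ "us @ vs"]) auto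
qed

section \<open>The characteristic polynomial of one clique\<close>

text \<open>For the all-ones matrix \<open>J\<close>, the matrix is \<open>d I + c J\<close>.
  Replacing the first unit vector by the all-ones vector, an eigenvector for \<open>d + n c\<close>,
  gives the base change \<open>P\<close>. In the new basis the matrix is the upper triangular
  \<open>T\<close>, whose remaining diagonal entries are \<open>d\<close>.\<close>

lemma char_poly_scalar_plus_all_ones:
  fixes c d :: "'c :: field"
  assumes "n > 0"
  shows "char_poly (mat n n (\<lambda>(i, j). if i = j then d + c else c))
       = [:- (d + of_nat n * c), 1:] * [:- d, 1:] ^ (n - 1)"
proof -
  define M where "M = mat n n (\<lambda>(i, j). if i = j then d + c else c)"
  define P :: "'c mat" where "P = mat n n (\<lambda>(i, j). if i = j \<or> j = 0 then 1 else 0)"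
  define Q :: "'c mat" where
    "Q = mat n n (\<lambda>(i, j). if i = j then 1 else if j = 0 then -1 else 0)"
  define T where
    "T = mat n n (\<lambda>(i, j). if i = j then (if i = 0 then d + of_nat n * c else d)
                            else if i = 0 then c else 0)"
  have carr: "M \<in> carrier_mat n n" "P \<in> carrier_mat n n" "Q \<in> carrier_mat n n"
    "T \<in> carrier_mat n n"
    by (auto simp: M_def P_def Q_def T_def)
  \<comment> \<open>Left multiplication by \<open>P\<close> adds row 0 to every other row. This
    formula evaluates both \<open>P * Q\<close> and \<open>P * T\<close>;
    \<open>index_mult_mat(1)\<close> is withheld there so that it applies before products are
    expanded.\<close>
  have P_mult: "(P * X) $$ (i, j) = (if i = 0 then X $$ (0, j) else X $$ (0, j) + X $$ (i, j))"
    if "X \<in> carrier_mat n n" "i < n" "j < n" for X :: "'c mat" and i j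
  proof -
    have "(P * X) $$ (i, j) = (\<Sum>k = 0..<n. (if i = k \<or> k = 0 then 1 else 0) * X $$ (k, j))"
      using that by (auto simp: P_def scalar_prod_def intro!: sum.cong)
    also have "\<dots> = (\<Sum>k\<in>{0, i}. X $$ (k, j))"
      using that by (intro sum.mono_neutral_cong_right) auto
    finally show ?thesis by auto
  qed
  have PQ: "P * Q = 1\<^sub>m n"
    using carr by (intro eq_matI) (auto simp: P_mult simp del: index_mult_mat(1), auto simp: Q_def)
  have QP: "Q * P = 1\<^sub>m n"
    using mat_mult_left_right_inverse[OF carr(2,3) PQ] .
  have MP: "M * P = P * T"
  proof (rule eq_matI)
    fix i j assume "i < dim_row (P * T)" "j < dim_col (P * T)"
    then have ij: "i < n" "j < n" using carr by auto
    have "(M * P) $$ (i, j) = (\<Sum>k = 0..<n. (if i = k then d + c else c) * (if k = j \<or> j = 0 then 1 else 0))"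
      using ij by (auto simp: M_def P_def scalar_prod_def intro!: sum.cong)
    also have "\<dots> = (P * T) $$ (i, j)"
    \<comment> \<open>Column 0 of \<open>P\<close> is the all-ones vector, on which \<open>M\<close>
      acts by its row sum \<open>d + n c\<close>; every other column is a unit vector.\<close>
    proof (cases "j = 0")
      case True
      have "(\<Sum>k = 0..<n. (if i = k then d + c else c) * (if k = j \<or> j = 0 then 1 else 0))
          = (\<Sum>k = 0..<n. (if i = k then d else 0) + c)"
        using True by (intro sum.cong) auto
      also have "\<dots> = d + of_nat n * c"
        using ij by (simp add: sum.distrib)
      finally show ?thesis
        using True ij carr by (auto simp: P_mult simp del: index_mult_mat(1)) (auto simp: T_def)
    next
      case False
      have "(\<Sum>k = 0..<n. (if i = k then d + c else c) * (if k = j \<or> j = 0 then 1 else 0))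
          = (\<Sum>k = 0..<n. if k = j then (if i = j then d + c else c) else 0)"
        using False by (intro sum.cong) auto
      then show ?thesis
        using False ij carr by (auto simp: P_mult simp del: index_mult_mat(1)) (auto simp: T_def)
    qed
    finally show "(M * P) $$ (i, j) = (P * T) $$ (i, j)" .
  qed (use carr in auto)
  have "M = M * (P * Q)" using carr PQ by simp
  also have "\<dots> = M * P * Q" using carr by (simp add: assoc_mult_mat[of _ n n _ n _ n])
  finally have "M = P * T * Q" by (simp only: MP)
  then have "similar_mat M T"
    unfolding similar_mat_def similar_mat_wit_def using PQ QP carr
    by (intro exI[of _ P] exI[of _ Q]) (auto simp: Let_def)
  then have "char_poly M = char_poly T" by (rule char_poly_similar)
  also have "\<dots> = (\<Prod>a\<leftarrow>diag_mat T. [:- a, 1:])"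
    using carr by (intro char_poly_upper_triangular[of _ n]) (auto simp: T_def upper_triangular_def)
  also have "diag_mat T = (d + of_nat n * c) # replicate (n - 1) d"
    using assms by (intro nth_equalityI) (auto simp: diag_mat_def T_def nth_Cons')
  finally show ?thesis by (simp add: M_def)
qed

lemma char_poly_list_mat_scalar_plus_all_ones:
  fixes f :: "'a \<Rightarrow> 'a \<Rightarrow> 'c :: field"
  assumes "distinct ws" and "set ws = C" and "C \<noteq> {}"
    and "\<And>x y. x \<in> C \<Longrightarrow> y \<in> C \<Longrightarrow> f x y = (if x = y then d + c else c)"
  shows "char_poly (list_mat f ws)
       = [:- (d + of_nat (card C) * c), 1:] * [:- d, 1:] ^ (card C - 1)"
proof -
  have len: "length ws = card C"
    using assms(1,2) distinct_card by metis
  have "list_mat f ws = mat (card C) (card C) (\<lambda>(i, j). if i = j then d + c else c)"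
    using assms(1,2,4) len by (auto simp: list_mat_def nth_eq_iff_index_eq intro!: eq_matI)
  moreover have "card C > 0"
    using assms(2,3) by (metis List.finite_set card_gt_0_iff)
  ultimately show ?thesis
    by (simp add: char_poly_scalar_plus_all_ones)
qed

text \<open>Here \<open>c C\<close> is the simple root of a block and \<open>d C\<close> the
  repeated one; they are eigenvalues, not the coefficients of the matrix.\<close>

lemma proots_prod_scalar_plus_all_ones:
  fixes c d :: "'b \<Rightarrow> 'c :: field"
  shows "proots (\<Prod>C\<in>P. [:- c C, 1:] * [:- d C, 1:] ^ k C)
       = (\<Sum>C\<in>P. add_mset (c C) (replicate_mset (k C) (d C)))"
proof -
  have roots: "proots ([:- c C, 1:] * [:- d C, 1:] ^ k C) = add_mset (c C) (replicate_mset (k C) (d C))"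
    for C
    by (subst proots_mult) (simp_all add: proots_power)
  have "[:- c C, 1:] * [:- d C, 1:] ^ k C \<noteq> 0" for C
    by (subst mult_eq_0_iff) simp
  then show ?thesis
    using proots_prod[of P "\<lambda>C. [:- c C, 1:] * [:- d C, 1:] ^ k C"] unfolding roots by blast
qed

section \<open>Disjoint unions of complete graphs\<close>

locale cluster_graph =
  fixes \<Gamma> :: "('a, 'b) pre_digraph" and P :: "'a set set"
  assumes graph: "graph \<Gamma>"
    and part: "partition_on (verts \<Gamma>) P"
    and adj: "\<And>C x y. C \<in> P \<Longrightarrow> x \<in> C \<Longrightarrow> y \<in> verts \<Gamma> \<Longrightarrow> x \<rightarrow>\<^bsub>\<Gamma>\<^esub> y \<longleftrightarrow> y \<in> C \<and> x \<noteq> y"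
begin

interpretation graph \<Gamma> by (rule graph)

lemma finite_partition: "finite P"
  using finite_elements[OF _ part] by simp

lemma finite_clique: "C \<in> P \<Longrightarrow> finite C"
  using part finite_verts by (metis Sup_upper finite_subset partition_onD1)

lemma out_degree_clique:
  assumes "C \<in> P" "x \<in> C"
  shows "out_degree \<Gamma> x = card C - 1"
proof -
  have x: "x \<in> verts \<Gamma>" using assms part by (auto dest: partition_onD1)
  \<comment> \<open>The out-degree counts arcs. Without parallel arcs the head map turns this into a
    count of neighbours.\<close>
  have "inj_on (head \<Gamma>) (out_arcs \<Gamma> x)"
    by (rule inj_onI) (auto intro!: no_multi_arcs simp: arc_to_ends_def)
  then have "out_degree \<Gamma> x = card (head \<Gamma> ` out_arcs \<Gamma> x)"
    by (simp add: out_degree_def card_image)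
  also have "head \<Gamma> ` out_arcs \<Gamma> x = {y \<in> verts \<Gamma>. x \<rightarrow>\<^bsub>\<Gamma>\<^esub> y}"
    by (force simp: arcs_ends_def arc_to_ends_def)
  also have "\<dots> = C - {x}"
    using adj[OF assms] assms(1) part by (auto dest: partition_onD1)
  finally show ?thesis using assms finite_clique by simp
qed

text \<open>Both matrices have the form \<open>D + e A\<close>, with \<open>e = -1\<close> or
  \<open>e = 1\<close>. On a clique with \<open>k\<close> vertices this is
  \<open>(k - 1 - e) I + e J\<close>, with eigenvalue \<open>k - 1 - e\<close> repeated
  \<open>k - 1\<close> times and the simple eigenvalue \<open>k - 1 - e + k e\<close>.\<close>

lemma
  shows L_spec_cluster_graph:
      "L_spec \<Gamma> = (\<Sum>C\<in>P. add_mset 0 (replicate_mset (card C - 1) (of_nat (card C))))"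
    and Q_spec_cluster_graph:
      "Q_spec \<Gamma> = (\<Sum>C\<in>P. add_mset (2 * of_nat (card C) - 2)
                                (replicate_mset (card C - 1) (of_nat (card C) - 2)))"
proof -
  define F :: "complex \<Rightarrow> 'a \<Rightarrow> 'a \<Rightarrow> complex" where
    "F e x y = (if x = y then of_nat (out_degree \<Gamma> x) else 0)
               + e * (if x \<rightarrow>\<^bsub>\<Gamma>\<^esub> y then 1 else 0)" for e x y
  have UP: "\<Union>P = verts \<Gamma>" using partition_onD1[OF part] by simp
  have lap: "laplacian_matrix \<Gamma> vs = list_mat (F (-1)) vs"
    and sig: "signless_laplacian_matrix \<Gamma> vs = list_mat (F 1) vs" if "distinct vs" for vs
    using that by (auto simp: laplacian_matrix_def signless_laplacian_matrix_def degree_matrix_def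
        adjacency_matrix_def list_mat_def F_def nth_eq_iff_index_eq intro!: eq_matI)
  have spec: "\<exists>vs. distinct vs \<and> set vs = verts \<Gamma> \<and> eigenvalue_mset (list_mat (F e) vs)
      = (\<Sum>C\<in>P. add_mset (of_nat (card C) - 1 - e + of_nat (card C) * e)
                  (replicate_mset (card C - 1) (of_nat (card C) - 1 - e)))" for e
  proof -
    let ?d = "\<lambda>C. of_nat (card C) - 1 - e :: complex"
    have "\<exists>vs. distinct vs \<and> set vs = \<Union>P \<and> char_poly (list_mat (F e) vs)
        = (\<Prod>C\<in>P. [:- (?d C + of_nat (card C) * e), 1:] * [:- ?d C, 1:] ^ (card C - 1))"
    proof (rule char_poly_partition)
      show "finite P" "disjoint P"
        using finite_partition part by (auto dest: partition_onD2)
      show "finite C" if "C \<in> P" for C using that by (rule finite_clique)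
      show "F e x y = 0 \<and> F e y x = 0" if C: "C \<in> P" "x \<in> C" "y \<in> \<Union>P - C" for C x y
      proof -
        obtain C' where C': "C' \<in> P" "y \<in> C'" using C(3) by blast
        have "x \<notin> C'" using C C' part by (metis DiffD2 IntI disjointD empty_iff partition_onD2)
        then show ?thesis
          using adj[OF C(1,2), of y] adj[OF C', of x] C UP by (auto simp: F_def)
      qed
      show "char_poly (list_mat (F e) ws)
          = [:- (?d C + of_nat (card C) * e), 1:] * [:- ?d C, 1:] ^ (card C - 1)"
        if C: "C \<in> P" "distinct ws" "set ws = C" for C ws
      proof (rule char_poly_list_mat_scalar_plus_all_ones)
        show "C \<noteq> {}" using C part partition_onD3 by blast
        \<comment> \<open>The degree \<open>card C - 1\<close> is a natural-number difference;
          nonemptiness lets it pass to the complex numbers.\<close>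
        then have "card C \<ge> 1" using C finite_clique by (simp add: Suc_leI card_gt_0_iff)
        then show "F e x y = (if x = y then ?d C + e else e)" if "x \<in> C" "y \<in> C" for x y
          using that C UP adj[of C x y] out_degree_clique[of C x] by (auto simp: F_def of_nat_diff)
      qed (use C in auto)
    qed
    then obtain vs where "distinct vs" "set vs = \<Union>P" "char_poly (list_mat (F e) vs)
        = (\<Prod>C\<in>P. [:- (?d C + of_nat (card C) * e), 1:] * [:- ?d C, 1:] ^ (card C - 1))"
      by blast
    then show ?thesis
      unfolding eigenvalue_mset_def UP
      by (intro exI[of _ vs]) (simp only: proots_prod_scalar_plus_all_ones)
  qed
  obtain vs where "distinct vs" "set vs = verts \<Gamma>" "eigenvalue_mset (list_mat (F (-1)) vs)
      = (\<Sum>C\<in>P. add_mset 0 (replicate_mset (card C - 1) (of_nat (card C))))"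
    using spec[of "-1"] by auto
  then show "L_spec \<Gamma> = (\<Sum>C\<in>P. add_mset 0 (replicate_mset (card C - 1) (of_nat (card C))))"
    using L_spec_any_enumeration[of \<Gamma> vs] lap by simp
  obtain vs where "distinct vs" "set vs = verts \<Gamma>" "eigenvalue_mset (list_mat (F 1) vs)
      = (\<Sum>C\<in>P. add_mset (2 * of_nat (card C) - 2)
                  (replicate_mset (card C - 1) (of_nat (card C) - 2)))"
    using spec[of 1] by (auto simp: algebra_simps)
  then show "Q_spec \<Gamma> = (\<Sum>C\<in>P. add_mset (2 * of_nat (card C) - 2)
                                (replicate_mset (card C - 1) (of_nat (card C) - 2)))"
    using Q_spec_any_enumeration[of \<Gamma> vs] sig by simp
qed

end

section \<open>The presented dihedral group\<close>

definition word_class :: "('g word \<times> 'g word) set \<Rightarrow> 'g word \<Rightarrow> 'g word set" where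
  "word_class R w = {u. word_eq R w u}"

lemma word_class_eq_iff: "word_class R u = word_class R v \<longleftrightarrow> word_eq R u v"
  unfolding word_class_def using word_eq.refl word_eq.sym word_eq.trans by blast

lemma carrier_presented_group: "carrier (presented_group R) = range (word_class R)"
  by (auto simp: presented_group_def word_class_def quotient_def)

lemma one_presented_group: "\<one>\<^bsub>presented_group R\<^esub> = word_class R []"
  by (simp add: presented_group_def word_class_def)

lemma mult_presented_group:
  "word_class R u \<otimes>\<^bsub>presented_group R\<^esub> word_class R v = word_class R (u @ v)"
proof -
  have "(\<exists>u'\<in>word_class R u. \<exists>v'\<in>word_class R v. word_eq R (u' @ v') w)
      \<longleftrightarrow> word_eq R (u @ v) w" (is "?L \<longleftrightarrow> ?R") for w
  proof
    assume ?L
    then obtain u' v' where "word_eq R u u'" "word_eq R v v'" "word_eq R (u' @ v') w"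
      by (auto simp: word_class_def)
    then show ?R by (meson word_eq.append word_eq.trans)
  next
    assume ?R
    moreover have "u \<in> word_class R u" "v \<in> word_class R v"
      by (simp_all add: word_class_def word_eq.refl)
    ultimately show ?L by blast
  qed
  then show ?thesis by (simp add: presented_group_def word_class_def)
qed

text \<open>A left inverse reverses the word and flips every letter. Appending a letter prepends its
  formal inverse to the left inverse, hence the induction from the end of the word.\<close>

lemma group_presented_group: "group (presented_group R)"
proof (rule groupI)
  fix X assume "X \<in> carrier (presented_group R)"
  then obtain w where w: "X = word_class R w" by (auto simp: carrier_presented_group)
  have "\<exists>v. word_eq R (v @ w) []"
  proof (induction w rule: rev_induct)
    case Nil
    show ?case by (rule exI[of _ "[]"]) (simp add: word_eq.refl)
  next
    case (snoc l w)
    then obtain v where v: "word_eq R (v @ w) []" by blast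
    obtain g s where l: "l = (g, s)" by force
    have "word_eq R ([(g, \<not> s)] @ (v @ w) @ [l]) ([(g, \<not> s)] @ [] @ [l])"
      by (intro word_eq.append word_eq.refl v)
    moreover have "word_eq R [(g, \<not> s), l] []"
      using word_eq.cancel[of R g "\<not> s"] by (simp add: l)
    ultimately have "word_eq R (((g, \<not> s) # v) @ w @ [l]) []"
      using word_eq.trans by fastforce
    then show ?case by blast
  qed
  then show "\<exists>Y\<in>carrier (presented_group R). Y \<otimes>\<^bsub>presented_group R\<^esub> X = \<one>\<^bsub>presented_group R\<^esub>"
    by (auto simp: w carrier_presented_group mult_presented_group one_presented_group word_class_eq_iff)
qed (auto simp: carrier_presented_group one_presented_group mult_presented_group)

lemma pow_presented_group:
  "word_class R [l] [^]\<^bsub>presented_group R\<^esub> (n :: nat) = word_class R (replicate n l)"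
proof (induction n)
  case 0
  then show ?case by (simp add: one_presented_group)
next
  case (Suc n)
  then show ?case by (simp add: mult_presented_group flip: replicate_append_same)
qed

section \<open>Normal forms and the order of the dihedral group\<close>

text \<open>This is the induction step for bringing words into the form \<open>a^i b^j\<close>, one
  letter at a time from the left. The exponents stay natural numbers and are reduced only
  afterwards.\<close>

lemma (in group) dihedral_words_closed:
  assumes a: "a \<in> carrier G" and b: "b \<in> carrier G"
    and rel: "a [^] (m :: nat) = \<one>" "b \<otimes> b = \<one>" "b \<otimes> a = inv a \<otimes> b" and m: "m > 0"
    and g: "g \<in> {a, inv a, b, inv b}"
    and h: "h \<in> {a [^] i \<otimes> b [^] j | (i :: nat) (j :: nat). True}"
  shows "g \<otimes> h \<in> {a [^] i \<otimes> b [^] j | (i :: nat) (j :: nat). True}"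
proof -
  have inv_a: "inv a = a [^] (m - 1)"
    using a m rel(1) by (intro inv_equality) (auto simp flip: nat_pow_Suc)
  have inv_b: "inv b = b" using b rel(2) by (intro inv_equality) auto
  \<comment> \<open>Moving \<open>b\<close> past a power of \<open>a\<close> negates the exponent;
    modulo \<open>m\<close> this is multiplication by \<open>m - 1\<close>.\<close>
  have ba: "b \<otimes> a [^] i = a [^] ((m - 1) * i) \<otimes> b" for i
  proof (induction i)
    case (Suc i)
    have "b \<otimes> a [^] Suc i = (b \<otimes> a [^] i) \<otimes> a" using a b by (simp add: m_assoc)
    also have "\<dots> = a [^] ((m - 1) * i) \<otimes> (b \<otimes> a)" using a b Suc by (simp add: m_assoc)
    also have "\<dots> = a [^] ((m - 1) * i) \<otimes> a [^] (m - 1) \<otimes> b"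
      using a b by (simp add: rel(3) inv_a m_assoc)
    also have "\<dots> = a [^] ((m - 1) * Suc i) \<otimes> b" using a by (simp add: nat_pow_mult add.commute)
    finally show ?case .
  qed (use b in simp)
  obtain i j :: nat where h: "h = a [^] i \<otimes> b [^] j" using h by blast
  have left_a: "a [^] k \<otimes> h = a [^] (k + i) \<otimes> b [^] j" for k :: nat
    using a b by (simp add: h m_assoc flip: nat_pow_mult)
  have left_b: "b \<otimes> h = a [^] ((m - 1) * i) \<otimes> b [^] Suc j"
  proof -
    have "b \<otimes> h = (b \<otimes> a [^] i) \<otimes> b [^] j" using a b by (simp add: h m_assoc)
    also have "\<dots> = a [^] ((m - 1) * i) \<otimes> (b \<otimes> b [^] j)" using a b by (simp add: ba m_assoc)
    finally show ?thesis using b by (simp only: nat_pow_Suc2)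
  qed
  have "a \<otimes> h = a [^] (1 + i) \<otimes> b [^] j" using left_a[of 1] a by simp
  then show ?thesis
    using g left_a[of "m - 1"] left_b unfolding inv_a inv_b by blast
qed

text \<open>\<open>(word_rotation, word_sign)\<close> evaluates a word in the semidirect product of \<open>\<int>\<close> and \<open>{1, -1}\<close>.
  Modulo \<open>m\<close> it respects the relations, which shows that \<open>D\<^sub>2\<^sub>m\<close> does not collapse.\<close>

primrec word_rotation :: "dihedral_gen word \<Rightarrow> int" where
  "word_rotation [] = 0"
| "word_rotation (l # w) =
    (case l of (Gen_a, s) \<Rightarrow> (if s then 1 else -1) + word_rotation w
             | (Gen_b, s) \<Rightarrow> - word_rotation w)"

primrec word_sign :: "dihedral_gen word \<Rightarrow> int" where
  "word_sign [] = 1"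
| "word_sign (l # w) = (case l of (Gen_a, s) \<Rightarrow> word_sign w | (Gen_b, s) \<Rightarrow> - word_sign w)"

lemma word_sign_append: "word_sign (u @ v) = word_sign u * word_sign v"
  by (induction u) (auto split: prod.splits dihedral_gen.splits)

lemma word_rotation_append: "word_rotation (u @ v) = word_rotation u + word_sign u * word_rotation v"
  by (induction u) (auto split: prod.splits dihedral_gen.splits)

definition dihedral_relations :: "nat \<Rightarrow> (dihedral_gen word \<times> dihedral_gen word) set" where
  "dihedral_relations m =
    {(replicate m (Gen_a, True), []),
     (replicate 2 (Gen_b, True), []),
     ([(Gen_b, True), (Gen_a, True), (Gen_b, False)], [(Gen_a, False)])}"

lemma dihedral_group_presented: "dihedral_group m = presented_group (dihedral_relations m)"
  by (simp add: dihedral_group_def dihedral_relations_def)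

lemma word_rotation_rotations: "word_rotation (replicate i (Gen_a, True) @ w) = int i + word_rotation w"
  and word_sign_rotations: "word_sign (replicate i (Gen_a, True) @ w) = word_sign w"
  by (induction i) auto

text \<open>Only the relation \<open>a^m = 1\<close> changes the rotation, by \<open>m\<close>,
  which is why a congruence is claimed. Equality of signs is carried along because in a
  concatenation the sign of the first word multiplies the rotation of the second.\<close>

lemma word_eq_dihedral_invariant:
  assumes "word_eq (dihedral_relations m) u v"
  shows "word_sign u = word_sign v \<and> [word_rotation u = word_rotation v] (mod int m)"
  using assms
proof (induction rule: word_eq.induct)
  case (cancel g s)
  then show ?case by (cases g) auto
next
  case (relation u v)
  then show ?case
    using word_rotation_rotations[of m "[]"] word_sign_rotations[of m "[]"]
    by (auto simp: dihedral_relations_def numeral_2_eq_2 cong_0_iff)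
next
  case (trans u v w)
  then show ?case using cong_trans by auto
next
  case (append u u' v v')
  then show ?case by (auto simp: word_sign_append word_rotation_append intro!: cong_add cong_scalar_left)
qed (auto intro: cong_sym)

text \<open>The relations bound the group from above by the \<open>2 m\<close> normal forms; the
  sign and the rotation modulo \<open>m\<close> show that these are distinct.\<close>

lemma dihedral_group_structure:
  assumes "m > 0"
  shows "\<exists>a \<in> carrier (dihedral_group m). \<exists>b \<in> carrier (dihedral_group m).
    carrier (dihedral_group m) = (\<lambda>i :: nat. a [^]\<^bsub>dihedral_group m\<^esub> i) ` {..<m}
      \<union> (\<lambda>i :: nat. a [^]\<^bsub>dihedral_group m\<^esub> i \<otimes>\<^bsub>dihedral_group m\<^esub> b) ` {..<m}
    \<and> card (carrier (dihedral_group m)) = 2 * m"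
proof -
  let ?R = "dihedral_relations m"
  let ?D = "presented_group ?R"
  interpret D: group ?D by (rule group_presented_group)
  define a where "a = word_class ?R [(Gen_a, True)]"
  define b where "b = word_class ?R [(Gen_b, True)]"
  have cls: "word_class ?R w \<in> carrier ?D" for w by (simp add: carrier_presented_group)
  have ab: "a \<in> carrier ?D" "b \<in> carrier ?D" by (simp_all add: a_def b_def cls)
  have inv_letter: "word_class ?R [(g, False)] = inv\<^bsub>?D\<^esub> word_class ?R [(g, True)]" for g
    using word_eq.cancel[of ?R g False]
    by (intro D.inv_equality[symmetric])
       (auto simp: cls mult_presented_group one_presented_group word_class_eq_iff)
  have pow_a: "a [^]\<^bsub>?D\<^esub> i = word_class ?R (replicate i (Gen_a, True))" for i :: nat
    by (simp add: a_def pow_presented_group)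
  have am: "a [^]\<^bsub>?D\<^esub> m = \<one>\<^bsub>?D\<^esub>"
    unfolding pow_a one_presented_group word_class_eq_iff
    by (rule word_eq.relation) (simp add: dihedral_relations_def)
  have bb: "b \<otimes>\<^bsub>?D\<^esub> b = \<one>\<^bsub>?D\<^esub>"
    unfolding b_def mult_presented_group one_presented_group word_class_eq_iff
    by (rule word_eq.relation) (simp add: dihedral_relations_def numeral_2_eq_2)
  have "b \<otimes>\<^bsub>?D\<^esub> (a \<otimes>\<^bsub>?D\<^esub> inv\<^bsub>?D\<^esub> b) = inv\<^bsub>?D\<^esub> a"
    unfolding a_def b_def inv_letter[symmetric] mult_presented_group word_class_eq_iff
    by (rule word_eq.relation) (simp add: dihedral_relations_def)
  then have "b \<otimes>\<^bsub>?D\<^esub> a \<otimes>\<^bsub>?D\<^esub> inv\<^bsub>?D\<^esub> b = inv\<^bsub>?D\<^esub> a"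
    using ab by (simp add: D.m_assoc)
  then have ba: "b \<otimes>\<^bsub>?D\<^esub> a = inv\<^bsub>?D\<^esub> a \<otimes>\<^bsub>?D\<^esub> b"
    using ab by (metis D.inv_closed D.inv_solve_right D.m_closed)
  let ?E = "(\<lambda>i :: nat. a [^]\<^bsub>?D\<^esub> i) ` {..<m} \<union> (\<lambda>i :: nat. a [^]\<^bsub>?D\<^esub> i \<otimes>\<^bsub>?D\<^esub> b) ` {..<m}"
  have word: "word_class ?R w \<in> {a [^]\<^bsub>?D\<^esub> i \<otimes>\<^bsub>?D\<^esub> b [^]\<^bsub>?D\<^esub> j | (i :: nat) (j :: nat). True}" for w
  proof (induction w)
    case Nil
    have "word_class ?R [] = a [^]\<^bsub>?D\<^esub> (0 :: nat) \<otimes>\<^bsub>?D\<^esub> b [^]\<^bsub>?D\<^esub> (0 :: nat)"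
      by (simp add: one_presented_group[symmetric])
    then show ?case by blast
  next
    case (Cons l w)
    have "word_class ?R [l] \<in> {a, inv\<^bsub>?D\<^esub> a, b, inv\<^bsub>?D\<^esub> b}"
      by (cases l; cases "fst l"; cases "snd l") (auto simp: a_def b_def inv_letter)
    from D.dihedral_words_closed[OF ab am bb ba assms this Cons]
    show ?case by (simp add: mult_presented_group)
  qed
  have "x \<in> ?E" if x: "x \<in> carrier ?D" for x
  proof -
    obtain i j :: nat where x: "x = a [^]\<^bsub>?D\<^esub> i \<otimes>\<^bsub>?D\<^esub> b [^]\<^bsub>?D\<^esub> j"
      using x word unfolding carrier_presented_group by blast
    have b2: "b [^]\<^bsub>?D\<^esub> (2 :: nat) = \<one>\<^bsub>?D\<^esub>" using bb ab by (simp add: numeral_2_eq_2)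
    have "a [^]\<^bsub>?D\<^esub> i = a [^]\<^bsub>?D\<^esub> (m * (i div m) + i mod m)" by simp
    also have "\<dots> = a [^]\<^bsub>?D\<^esub> (i mod m)"
      using ab am by (simp only: D.nat_pow_mult[symmetric] D.nat_pow_pow[symmetric]) simp
    finally have ai: "a [^]\<^bsub>?D\<^esub> i = a [^]\<^bsub>?D\<^esub> (i mod m)" .
    have "b [^]\<^bsub>?D\<^esub> j = b [^]\<^bsub>?D\<^esub> (2 * (j div 2) + j mod 2)" by simp
    also have "\<dots> = b [^]\<^bsub>?D\<^esub> (j mod 2)"
      using ab b2 by (simp only: D.nat_pow_mult[symmetric] D.nat_pow_pow[symmetric]) simp
    finally have bj: "b [^]\<^bsub>?D\<^esub> j = b [^]\<^bsub>?D\<^esub> (j mod 2)" .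
    show ?thesis
      using assms ab by (cases "even j") (auto simp: x ai bj odd_iff_mod_2_eq_one)
  qed
  then have E: "carrier ?D = ?E" using ab by auto
  have cong_less: "i = j" if "i < m" "j < m" "[int i = int j] (mod int m)" for i j
    using that by (simp add: cong_int_iff cong_less_modulus_unique_nat)
  have mult_b: "a [^]\<^bsub>?D\<^esub> i \<otimes>\<^bsub>?D\<^esub> b = word_class ?R (replicate i (Gen_a, True) @ [(Gen_b, True)])" for i
    by (simp add: pow_a b_def mult_presented_group)
  have rot: "word_rotation (replicate i (Gen_a, True)) = int i" "word_sign (replicate i (Gen_a, True)) = 1" for i
    using word_rotation_rotations[of i "[]"] word_sign_rotations[of i "[]"] by auto
  \<comment> \<open>The rotation separates the elements within each family, the sign separates the
    two families.\<close>
  have "inj_on (\<lambda>i :: nat. a [^]\<^bsub>?D\<^esub> i) {..<m}"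
    by (rule inj_onI)
       (auto simp: pow_a word_class_eq_iff rot intro: cong_less dest!: word_eq_dihedral_invariant)
  moreover have "inj_on (\<lambda>i :: nat. a [^]\<^bsub>?D\<^esub> i \<otimes>\<^bsub>?D\<^esub> b) {..<m}"
    by (rule inj_onI)
       (auto simp: mult_b word_class_eq_iff word_rotation_rotations intro: cong_less
          dest!: word_eq_dihedral_invariant)
  moreover have "(\<lambda>i :: nat. a [^]\<^bsub>?D\<^esub> i) ` {..<m} \<inter> (\<lambda>i :: nat. a [^]\<^bsub>?D\<^esub> i \<otimes>\<^bsub>?D\<^esub> b) ` {..<m} = {}"
    by (auto simp: pow_a mult_b)
       (auto simp: b_def mult_presented_group word_class_eq_iff word_sign_rotations rot dest!: word_eq_dihedral_invariant)
  ultimately have "card ?E = 2 * m" by (subst card_Un_disjoint) (auto simp: card_image)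
  with E ab show ?thesis unfolding dihedral_group_presented by auto
qed

section \<open>Commutation in groups with dihedral central quotient\<close>

context group
begin

text \<open>This and the following closure fact serve twice: for the centre and for the centraliser
  of a single element.\<close>

lemma inv_commute:
  assumes "a \<in> carrier G" "x \<in> carrier G" "a \<otimes> x = x \<otimes> a"
  shows "inv a \<otimes> x = x \<otimes> inv a"
proof -
  have "x = a \<otimes> (x \<otimes> inv a)"
    using assms by (simp flip: m_assoc) (simp add: m_assoc)
  then show ?thesis
    using assms(1,2) by (metis inv_closed inv_solve_left m_closed)
qed

lemma mult_commute:
  assumes "a \<in> carrier G" "b \<in> carrier G" "x \<in> carrier G"
    and "a \<otimes> x = x \<otimes> a" "b \<otimes> x = x \<otimes> b"
  shows "a \<otimes> b \<otimes> x = x \<otimes> (a \<otimes> b)"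
proof -
  have "a \<otimes> b \<otimes> x = a \<otimes> (x \<otimes> b)" using assms by (simp add: m_assoc)
  also have "\<dots> = a \<otimes> x \<otimes> b" using assms(1-3) by (simp add: m_assoc)
  finally show ?thesis using assms by (simp add: m_assoc)
qed

lemma subgroup_group_center: "subgroup (group_center G) G"
proof (rule subgroupI)
  show "group_center G \<noteq> {}" by (auto simp: group_center_def intro!: exI[of _ "\<one>"])
next
  fix a assume a: "a \<in> group_center G"
  have "inv a \<otimes> x = x \<otimes> inv a" if "x \<in> carrier G" for x
    using a that inv_commute unfolding group_center_def by blast
  then show "inv a \<in> group_center G" using a unfolding group_center_def by blast
next
  fix a b assume ab: "a \<in> group_center G" "b \<in> group_center G"
  have "a \<otimes> b \<otimes> x = x \<otimes> (a \<otimes> b)" if "x \<in> carrier G" for x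
    using ab that mult_commute unfolding group_center_def by blast
  then show "a \<otimes> b \<in> group_center G" using ab unfolding group_center_def by blast
qed (auto simp: group_center_def)

lemma normal_group_center: "group_center G \<lhd> G"
proof -
  have "group_center G #> x = x <# group_center G" if "x \<in> carrier G" for x
    using that by (auto simp: r_coset_def l_coset_def group_center_def)
  then show ?thesis using subgroup_group_center by (simp add: normal_def normal_axioms_def is_group)
qed

lemma pow_commute_self: "x \<in> carrier G \<Longrightarrow> x [^] (i :: nat) \<otimes> x = x \<otimes> x [^] i"
  using nat_pow_Suc2 by simp

lemma group_center_product_commute:
  assumes "z \<in> group_center G" "x \<in> carrier G" "y \<in> carrier G" "x \<otimes> y = y \<otimes> x"
  shows "(z \<otimes> x) \<otimes> y = y \<otimes> (z \<otimes> x)"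
  using assms unfolding group_center_def by (intro mult_commute) blast+

lemma coset_group_center_eq_iff:
  assumes "x \<in> carrier G" "y \<in> carrier G"
  shows "group_center G #> x = group_center G #> y \<longleftrightarrow> y \<otimes> inv x \<in> group_center G"
proof -
  have "group_center G #> x = group_center G #> y \<longleftrightarrow> y \<in> group_center G #> x"
    using assms subgroup_group_center repr_independence repr_independenceD by blast
  also have "\<dots> \<longleftrightarrow> y \<otimes> inv x \<in> group_center G"
    using assms subgroup.rcos_module[OF subgroup_group_center is_group] by simp
  finally show ?thesis .
qed

text \<open>An element commuting with both \<open>A\<close> and some \<open>h \<notin> A\<close> is central, since \<open>G = A \<union> A h\<close>;
  for the second claim this is applied to \<open>k\<close> times the inverse of \<open>h\<close>, an element of \<open>A\<close>.\<close>

lemma abelian_index_two_commute: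
  assumes A: "subgroup A G" and abelian: "\<And>a b. a \<in> A \<Longrightarrow> b \<in> A \<Longrightarrow> a \<otimes> b = b \<otimes> a"
    and index: "\<And>h k. h \<in> carrier G - A \<Longrightarrow> k \<in> carrier G - A \<Longrightarrow> k \<otimes> inv h \<in> A"
    and h: "h \<in> carrier G - A"
  shows "a \<in> A \<Longrightarrow> a \<otimes> h = h \<otimes> a \<Longrightarrow> a \<in> group_center G"
    and "k \<in> carrier G - A \<Longrightarrow>
      k \<otimes> h = h \<otimes> k \<longleftrightarrow> group_center G #> h = group_center G #> k"
proof -
  have sub: "A \<subseteq> carrier G" using A by (rule subgroup.subset)
  have central: "a \<in> group_center G" if a: "a \<in> A" "a \<otimes> h = h \<otimes> a" for a
  proof -
    have "a \<otimes> g = g \<otimes> a" if g: "g \<in> carrier G" for g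
    proof (cases "g \<in> A")
      case True
      then show ?thesis using a abelian by blast
    next
      case False
      define b where "b = g \<otimes> inv h"
      have b: "b \<in> A" "b \<in> carrier G" "a \<in> carrier G" "h \<in> carrier G"
        using index[OF h] False g a h sub by (auto simp: b_def)
      have g_eq: "g = b \<otimes> h" using g h by (simp add: b_def m_assoc)
      have "a \<otimes> (b \<otimes> h) = b \<otimes> a \<otimes> h" using abelian[of a b] a b by (simp flip: m_assoc)
      also have "\<dots> = b \<otimes> h \<otimes> a" using a b by (simp add: m_assoc)
      finally show ?thesis by (simp add: g_eq)
    qed
    then show ?thesis using a sub by (auto simp: group_center_def)
  qed
  then show "a \<in> A \<Longrightarrow> a \<otimes> h = h \<otimes> a \<Longrightarrow> a \<in> group_center G" .
  assume k: "k \<in> carrier G - A"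
  define b where "b = k \<otimes> inv h"
  have b: "b \<in> A" "b \<in> carrier G" using index[OF h k] sub by (auto simp: b_def)
  have k_eq: "k = b \<otimes> h" using h k by (simp add: b_def m_assoc)
  \<comment> \<open>Since \<open>k = b h\<close>, the equation \<open>k h = h k\<close> reads
    \<open>b h h = h b h\<close>, and \<open>h\<close> cancels on the right.\<close>
  have "k \<otimes> h = h \<otimes> k \<longleftrightarrow> b \<otimes> h = h \<otimes> b"
    using b h right_cancel[of h "b \<otimes> h" "h \<otimes> b"] by (simp add: k_eq m_assoc)
  also have "\<dots> \<longleftrightarrow> b \<in> group_center G"
    using central b h by (auto simp: group_center_def)
  also have "\<dots> \<longleftrightarrow> group_center G #> h = group_center G #> k"
    using h k by (simp add: coset_group_center_eq_iff b_def)
  finally show "k \<otimes> h = h \<otimes> k \<longleftrightarrow> group_center G #> h = group_center G #> k" .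
qed

section \<open>The partition of the non-central elements into cliques\<close>

text \<open>The witnesses are \<open>C = A - Z\<close>, with \<open>A\<close> the centraliser of
  \<open>x\<close>, and the set \<open>Q\<close> of the cosets of the elements \<open>x^i y\<close>.
  That there are \<open>2 m\<close> cosets forces \<open>x\<close> and \<open>y\<close> not to
  commute and makes both listings free of repetitions. In the last conjunct \<open>u = v\<close> is
  allowed; loops are excluded only in the graph.\<close>

lemma dihedral_quotient_commuting_partition:
  fixes m :: nat
  defines "Z \<equiv> group_center G"
  assumes fin: "finite (carrier G)" and m: "m \<ge> 2"
    and x: "x \<in> carrier G" and y: "y \<in> carrier G"
    and cosets: "rcosets Z = (\<lambda>i :: nat. Z #> x [^] i) ` {..<m}
                             \<union> (\<lambda>i :: nat. Z #> (x [^] i \<otimes> y)) ` {..<m}"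
    and card_cosets: "card (rcosets Z) = 2 * m"
  shows "\<exists>C Q. partition_on (carrier G - Z) (insert C Q) \<and> C \<notin> Q
    \<and> card C = (m - 1) * card Z \<and> card Q = m \<and> (\<forall>B\<in>Q. card B = card Z)
    \<and> (\<forall>B\<in>insert C Q. \<forall>u\<in>B. \<forall>v\<in>carrier G - Z. u \<otimes> v = v \<otimes> u \<longleftrightarrow> v \<in> B)"
proof -
  interpret Z: subgroup Z G unfolding Z_def by (rule subgroup_group_center)
  have Zc: "z \<otimes> g = g \<otimes> z" if "z \<in> Z" "g \<in> carrier G" for z g
    using that unfolding Z_def group_center_def by blast
  define K where "K = (\<lambda>i :: nat. Z #> x [^] i) ` {..<m}"
  define Q where "Q = (\<lambda>i :: nat. Z #> (x [^] i \<otimes> y)) ` {..<m}"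
  define A where "A = {g \<in> carrier G. g \<otimes> x = x \<otimes> g}"
  have A: "subgroup A G"
  proof (rule subgroupI)
    show "inv a \<in> A" if "a \<in> A" for a
      using that x inv_commute by (simp add: A_def)
    show "a \<otimes> b \<in> A" if "a \<in> A" "b \<in> A" for a b
      using that x mult_commute[of a b x] by (simp add: A_def)
  qed (use x in \<open>auto simp: A_def\<close>)
  have ZA: "Z \<subseteq> A" using x Zc Z.subset by (auto simp: A_def)
  have pow_A: "x [^] (i :: nat) \<in> A" for i
    using x pow_commute_self[of x i] by (simp add: A_def)
  have ZK_A: "z \<otimes> x [^] (i :: nat) \<in> A" if "z \<in> Z" for z i
    using subgroup.m_closed[OF A] ZA that pow_A by blast
  have K_A: "B \<subseteq> A" if "B \<in> K" for B
    using that ZK_A unfolding K_def r_coset_def by blast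
  have form: "(\<exists>z\<in>Z. \<exists>i. g = z \<otimes> x [^] (i :: nat)) \<or> (\<exists>z\<in>Z. \<exists>i. g = z \<otimes> (x [^] (i :: nat) \<otimes> y))"
    if g: "g \<in> carrier G" for g
  proof -
    have "Z #> g \<in> rcosets Z" using g Z.subset by (simp add: rcosetsI)
    moreover have "g \<in> Z #> g" using g by (simp add: rcos_self Z.subgroup_axioms)
    ultimately show ?thesis unfolding cosets by (fastforce simp: r_coset_def)
  qed
  have commute_form: "g \<otimes> (z \<otimes> x [^] (i :: nat)) = (z \<otimes> x [^] i) \<otimes> g"
    if g: "g \<in> A" and z: "z \<in> Z" for g z i
  proof -
    have g': "g \<in> carrier G" "g \<otimes> x = x \<otimes> g" using g by (auto simp: A_def)
    have "x [^] i \<otimes> g = g \<otimes> x [^] i"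
    proof (induction i)
      case (Suc i)
      have "x [^] Suc i \<otimes> g = x [^] i \<otimes> g \<otimes> x" using g' x by (simp add: m_assoc)
      then show ?case using Suc g' x by (simp add: m_assoc)
    qed (use g' in simp)
    then show ?thesis using group_center_product_commute[of z "x [^] i" g] z g' x by (simp add: Z_def)
  qed
  have y_A: "y \<notin> A"
  proof
    assume "y \<in> A"
    text \<open>Then \<open>x\<close> and \<open>y\<close> are both central, which leaves only one coset of \<open>Z\<close>.\<close>
    then have xy: "x \<otimes> y = y \<otimes> x" by (simp add: A_def)
    have A_all: "g \<in> A" if g: "g \<in> carrier G" for g
      using form[OF g]
    proof (elim disjE bexE exE)
      fix z i assume "z \<in> Z" "g = z \<otimes> x [^] (i :: nat)"
      then show ?thesis using ZK_A by blast
    next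
      fix z i assume *: "z \<in> Z" "g = z \<otimes> (x [^] (i :: nat) \<otimes> y)"
      have "x [^] i \<otimes> y \<otimes> x = x [^] i \<otimes> x \<otimes> y" using x y xy by (simp add: m_assoc)
      also have "\<dots> = x \<otimes> (x [^] i \<otimes> y)" using x y pow_commute_self[of x i] by (simp add: m_assoc)
      finally show ?thesis
        using group_center_product_commute[of z "x [^] i \<otimes> y" x] x y g * by (simp add: A_def Z_def)
    qed
    have "x \<otimes> g = g \<otimes> x" if "g \<in> carrier G" for g
      using A_all[OF that] by (simp add: A_def)
    then have "x \<in> Z" using x unfolding Z_def group_center_def by blast
    then have pow_Z: "x [^] i \<in> Z" for i :: nat
      by (induction i) auto
    \<comment> \<open>With \<open>x\<close> central the listed cosets collapse to \<open>Z\<close>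
      and \<open>Z y\<close>; centrality of \<open>y\<close> then merges these two.\<close>
    then have "Z #> x [^] i = Z" for i :: nat
      using coset_join2[of "x [^] i" Z] Z.subgroup_axioms by (simp add: x)
    moreover have "Z #> (x [^] i \<otimes> y) = Z #> y" for i :: nat
      using coset_mult_assoc[of Z "x [^] i" y] coset_join2[of "x [^] i" Z] pow_Z x y
        Z.subgroup_axioms Z.subset by simp
    ultimately have "rcosets Z \<subseteq> {Z, Z #> y}" unfolding cosets by auto
    moreover have "y \<in> Z"
    proof -
      have "y \<otimes> g = g \<otimes> y" if g: "g \<in> carrier G" for g
        using form[OF g]
      proof (elim disjE bexE exE)
        fix z i assume "z \<in> Z" "g = z \<otimes> x [^] (i :: nat)"
        then show ?thesis using commute_form[OF \<open>y \<in> A\<close>] by blast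
      next
        fix z i assume *: "z \<in> Z" "g = z \<otimes> (x [^] (i :: nat) \<otimes> y)"
        have "x [^] i \<otimes> y = y \<otimes> x [^] i"
          using commute_form[OF \<open>y \<in> A\<close>, of \<one> i] x by simp
        then have "(x [^] i \<otimes> y) \<otimes> y = y \<otimes> (x [^] i \<otimes> y)" using x y by (simp add: m_assoc)
        then show ?thesis
          using group_center_product_commute[of z "x [^] i \<otimes> y" y] x y * by (simp add: Z_def)
      qed
      then show ?thesis using y unfolding Z_def group_center_def by blast
    qed
    then have "Z #> y = Z" using coset_join2[of y Z] y Z.subgroup_axioms by simp
    ultimately have "rcosets Z \<subseteq> {Z}" by auto
    then have "card (rcosets Z) \<le> 1" using card_mono[of "{Z}" "rcosets Z"] by simp
    then show False using card_cosets m by simp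
  qed
  have Q_form: "\<exists>z\<in>Z. \<exists>i. g = z \<otimes> (x [^] (i :: nat) \<otimes> y)" if "B \<in> Q" "g \<in> B" for B g
    using that unfolding Q_def r_coset_def by blast
  \<comment> \<open>If \<open>z x^i y\<close> were in \<open>A\<close>, dividing by
    \<open>z x^i\<close>, which lies in \<open>A\<close>, would put \<open>y\<close> into
    \<open>A\<close>.\<close>
  have Q_A: "B \<inter> A = {}" if B: "B \<in> Q" for B
  proof -
    have False if "g \<in> B" "g \<in> A" for g
    proof -
      obtain z i where g: "z \<in> Z" "g = z \<otimes> (x [^] (i :: nat) \<otimes> y)"
        using Q_form[OF B \<open>g \<in> B\<close>] by blast
      define w where "w = z \<otimes> x [^] i"
      have w: "w \<in> A" using ZK_A g by (simp add: w_def)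
      then have w': "w \<in> carrier G" by (simp add: A_def)
      have "g = w \<otimes> y" using g x y Z.mem_carrier by (simp add: w_def m_assoc)
      then have "y = inv w \<otimes> g" using w' y by (simp flip: m_assoc)
      then have "y \<in> A"
        using subgroup.m_closed[OF A] subgroup.m_inv_closed[OF A w] that by simp
      then show False using y_A by simp
    qed
    then show ?thesis by blast
  qed
  have UKQ: "\<Union>K \<union> \<Union>Q = carrier G"
    using rcosets_part_G[OF Z.subgroup_axioms] unfolding cosets K_def Q_def by blast
  \<comment> \<open>The two unions cover the group, one inside \<open>A\<close> and the other
    disjoint from it, so both inclusions are equalities.\<close>
  have UK: "\<Union>K = A" and UQ: "\<Union>Q = carrier G - A"
    using UKQ K_A Q_A subgroup.subset[OF A] by blast+
  have abelian: "a \<otimes> b = b \<otimes> a" if "a \<in> A" "b \<in> A" for a b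
  proof -
    obtain z i where "z \<in> Z" "b = z \<otimes> x [^] (i :: nat)" 
      using \<open>b \<in> A\<close> UK unfolding K_def r_coset_def by blast
    then show ?thesis using commute_form that by blast
  qed
  \<comment> \<open>Every element outside \<open>A\<close> has the form \<open>a y\<close> with
    \<open>a\<close> in \<open>A\<close>, so \<open>y\<close> cancels in the quotient of two of
    them.\<close>
  have index: "k \<otimes> inv h \<in> A" if hk: "h \<in> carrier G - A" "k \<in> carrier G - A" for h k
  proof -
    have out: "\<exists>a\<in>A. g = a \<otimes> y" if g: "g \<in> carrier G - A" for g
    proof -
      obtain B where "B \<in> Q" "g \<in> B" using g UQ by blast
      from Q_form[OF this] obtain z i where g': "z \<in> Z" "g = z \<otimes> (x [^] (i :: nat) \<otimes> y)"
        by blast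
      have "z \<otimes> x [^] i \<in> A" using ZK_A g' by blast
      moreover have "g = (z \<otimes> x [^] i) \<otimes> y" using g' x y Z.subset by (auto simp: m_assoc)
      ultimately show ?thesis by blast
    qed
    obtain a b where ab: "a \<in> A" "b \<in> A" "h = a \<otimes> y" "k = b \<otimes> y" using out hk by metis
    have c: "a \<in> carrier G" "b \<in> carrier G" using ab by (auto simp: A_def)
    have "k \<otimes> inv h = b \<otimes> (y \<otimes> inv y) \<otimes> inv a"
      using c y by (simp only: ab inv_mult_group m_assoc inv_closed m_closed)
    then have "k \<otimes> inv h = b \<otimes> inv a" using c y by simp
    then show ?thesis using A ab by (simp add: subgroup.m_closed subgroup.m_inv_closed)
  qed
  have finKQ: "finite K" "finite Q" by (auto simp: K_def Q_def)
  \<comment> \<open>Each family has at most \<open>m\<close> cosets and together they have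
    \<open>2 m\<close>, so each has exactly \<open>m\<close>.\<close>
  have "card K \<le> m" "card Q \<le> m"
    using card_image_le[of "{..<m}"] by (auto simp: K_def Q_def)
  moreover have "2 * m \<le> card K + card Q"
    using card_cosets card_Un_le[of K Q] unfolding cosets K_def Q_def by simp
  ultimately have card_K: "card K = m" and card_Q: "card Q = m" by auto
  have KQ: "K \<subseteq> rcosets Z" "Q \<subseteq> rcosets Z" unfolding cosets K_def Q_def by auto
  have card_coset: "card B = card Z" if "B \<in> rcosets Z" for B
    using card_rcosets_equal[OF that Z.subset] by simp
  have disj: "disjoint (rcosets Z)" using rcos_disjoint[OF Z.subgroup_axioms] .
  have "card Z * card K = card (\<Union>K)"
  proof (rule card_partition)
    show "finite (\<Union>K)" using UKQ fin by (metis finite_Un)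
    show "card B = card Z" if "B \<in> K" for B using that KQ card_coset by blast
    show "B \<inter> B' = {}" if "B \<in> K" "B' \<in> K" "B \<noteq> B'" for B B'
      using disjointD[OF disj, of B B'] that KQ by blast
  qed (rule finKQ)
  then have "card A = m * card Z" by (simp add: UK card_K mult.commute)
  then have card_C: "card (A - Z) = (m - 1) * card Z"
    using ZA finite_subset[OF Z.subset fin] by (simp add: card_Diff_subset diff_mult_distrib)
  have "Z \<noteq> {}" using Z.one_closed by blast
  then have "card Z > 0" using finite_subset[OF Z.subset fin] by (simp add: card_gt_0_iff)
  \<comment> \<open>Blocks of a partition must be nonempty; for \<open>A - Z\<close> this follows
    from \<open>m >= 2\<close>.\<close>
  then have C_ne: "A - Z \<noteq> {}" using card_C m by (metis card.empty diff_is_0_eq mult_is_0 not_less_eq_eq numeral_2_eq_2 zero_less_iff_neq_zero One_nat_def)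
  have ne: "{} \<notin> Q" using KQ card_coset \<open>card Z > 0\<close> by (metis card.empty less_numeral_extra(3) subsetD)
  have part: "partition_on (carrier G - Z) (insert (A - Z) Q)"
  proof (rule partition_onI)
    show "\<Union>(insert (A - Z) Q) = carrier G - Z" using UQ ZA subgroup.subset[OF A] by auto
    show "disjnt p q" if "p \<in> insert (A - Z) Q" "q \<in> insert (A - Z) Q" "p \<noteq> q" for p q
      using that Q_A KQ(2) disjointD[OF disj, of p q] unfolding disjnt_def by blast
  qed (use C_ne ne in auto)
  have "u \<otimes> v = v \<otimes> u \<longleftrightarrow> v \<in> B"
    if B: "B \<in> insert (A - Z) Q" "u \<in> B" and v: "v \<in> carrier G - Z" for B u v
  proof (cases "B = A - Z")
    case True
    then show ?thesis
      \<comment> \<open>If \<open>v\<close> were outside \<open>A\<close>, commuting with it would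
        make \<open>u\<close> central.\<close>
      using B v abelian abelian_index_two_commute(1)[OF A abelian index, of v u] by (auto simp: Z_def)
  next
    case False
    then have BQ: "B \<in> Q" "u \<in> carrier G - A" using B UQ by auto
    have B_eq: "B = Z #> u"
    proof -
      obtain g where "g \<in> carrier G" "B = Z #> g" using BQ KQ by (auto simp: RCOSETS_def)
      then show ?thesis using B(2) repr_independence Z.subgroup_axioms by blast
    qed
    show ?thesis
    proof (cases "v \<in> A")
      case True
      \<comment> \<open>Both sides are false: \<open>v\<close> is non-central in \<open>A\<close>,
        so it does not commute with \<open>u\<close>, and \<open>B\<close> is disjoint from
        \<open>A\<close>.\<close>
      then show ?thesis
        using v BQ Q_A abelian_index_two_commute(1)[OF A abelian index BQ(2), of v] by (auto simp: Z_def)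
    next
      case False
      then have vA: "v \<in> carrier G - A" using v by simp
      have "u \<otimes> v = v \<otimes> u \<longleftrightarrow> Z #> u = Z #> v"
        using abelian_index_two_commute(2)[OF A abelian index BQ(2) vA] by (auto simp: Z_def)
      also have "\<dots> \<longleftrightarrow> v \<in> B"
        unfolding B_eq using v BQ repr_independence repr_independenceD Z.subgroup_axioms by blast
      finally show ?thesis .
    qed
  qed
  moreover have "A - Z \<notin> Q" using C_ne Q_A by blast
  ultimately show ?thesis
    using part card_C card_Q KQ card_coset
    by (intro exI[of _ "A - Z"] exI[of _ Q]) auto
qed

end

section \<open>Transfer of the dihedral structure to the cosets of the centre\<close>

text \<open>The inverse isomorphism sends the normal forms of the dihedral group to cosets;
  \<open>x\<close> and \<open>y\<close> are arbitrary representatives of the images of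
  \<open>a\<close> and \<open>b\<close>.\<close>

lemma dihedral_quotient_cosets:
  fixes G (structure) and m :: nat
  assumes m: "m \<ge> 2" and G: "group G" and iso: "G Mod group_center G \<cong> dihedral_group m"
  shows "\<exists>x\<in>carrier G. \<exists>y\<in>carrier G.
    rcosets (group_center G) = (\<lambda>i :: nat. group_center G #> x [^] i) ` {..<m}
                             \<union> (\<lambda>i :: nat. group_center G #> (x [^] i \<otimes> y)) ` {..<m}
    \<and> card (rcosets (group_center G)) = 2 * m"
proof -
  interpret group G by (rule G)
  define Z where "Z = group_center G"
  interpret Z: normal Z G unfolding Z_def by (rule normal_group_center)
  let ?D = "dihedral_group m" and ?H = "G Mod Z"
  interpret H: group ?H by (rule Z.factorgroup_is_group)
  interpret D: group ?D unfolding dihedral_group_presented by (rule group_presented_group)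
  obtain \<phi> where \<phi>: "\<phi> \<in> iso ?D ?H"
    using H.iso_sym iso unfolding Z_def is_iso_def by blast
  then have bij: "bij_betw \<phi> (carrier ?D) (carrier ?H)" and hom: "\<phi> \<in> hom ?D ?H"
    by (auto simp: iso_def)
  interpret hom: group_hom ?D ?H \<phi>
    using hom by unfold_locales
  obtain a b where ab: "a \<in> carrier ?D" "b \<in> carrier ?D"
    and D: "carrier ?D = (\<lambda>i :: nat. a [^]\<^bsub>?D\<^esub> i) ` {..<m}
      \<union> (\<lambda>i :: nat. a [^]\<^bsub>?D\<^esub> i \<otimes>\<^bsub>?D\<^esub> b) ` {..<m}"
    and card_D: "card (carrier ?D) = 2 * m"
    using dihedral_group_structure[of m] m by auto
  have "\<phi> a \<in> carrier ?H" "\<phi> b \<in> carrier ?H" using ab by auto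
  then obtain x y where x: "x \<in> carrier G" "\<phi> a = Z #> x" and y: "y \<in> carrier G" "\<phi> b = Z #> y"
    unfolding carrier_FactGroup by blast
  have pow: "\<phi> (a [^]\<^bsub>?D\<^esub> i) = Z #> x [^] i" for i :: nat
    using hom.hom_nat_pow[OF ab(1)] x Z.FactGroup_pow by simp
  have pow_mult: "\<phi> (a [^]\<^bsub>?D\<^esub> i \<otimes>\<^bsub>?D\<^esub> b) = Z #> (x [^] i \<otimes> y)" for i :: nat
    using ab x y by (simp add: pow Z.rcos_sum)
  have H: "carrier ?H = rcosets Z" by (simp add: FactGroup_def)
  have "rcosets Z = \<phi> ` carrier ?D" using bij H by (simp add: bij_betw_def)
  also have "\<dots> = (\<lambda>i :: nat. Z #> x [^] i) ` {..<m} \<union> (\<lambda>i :: nat. Z #> (x [^] i \<otimes> y)) ` {..<m}"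
    by (simp add: D image_Un image_image pow pow_mult)
  finally have "rcosets Z = \<dots>" .
  moreover have "card (rcosets Z) = 2 * m" using bij_betw_same_card[OF bij] card_D H by simp
  ultimately show ?thesis using x y unfolding Z_def by blast
qed

section \<open>Collecting the eigenvalues\<close>

text \<open>Blocks of equal size contribute equal multisets. The eigenvalues are functions
  \<open>c\<close> and \<open>d\<close> of the block size, so both spectra are covered.\<close>

lemma sum_add_mset_replicate:
  assumes "finite Q" and "\<And>B. B \<in> Q \<Longrightarrow> card B = n"
  shows "(\<Sum>B\<in>Q. add_mset (c (card B)) (replicate_mset (card B - 1) (d (card B))))
       = replicate_mset (card Q) (c n) + replicate_mset (card Q * (n - 1)) (d n)"
  using assms by (induction Q rule: finite_induct) (auto simp: multiset_eq_iff)

theorem theorem2p5: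
  fixes G :: "('a, 'b) monoid_scheme" and m :: nat
  assumes "m \<ge> 2"
    and "group G"
    and "finite (carrier G)"
    and "G Mod group_center G \<cong> dihedral_group m"
  shows "L_spec (commuting_graph G) =
           replicate_mset (m + 1) 0
         + replicate_mset ((m - 1) * card (group_center G) - 1)
             ((of_nat m - 1) * of_nat (card (group_center G)))
         + replicate_mset (m * (card (group_center G) - 1))
             (of_nat (card (group_center G)))
     \<and> Q_spec (commuting_graph G) =
           replicate_mset 1 (2 * (of_nat m - 1) * of_nat (card (group_center G)) - 2)
         + replicate_mset ((m - 1) * card (group_center G) - 1)
             ((of_nat m - 1) * of_nat (card (group_center G)) - 2)
         + replicate_mset m (2 * of_nat (card (group_center G)) - 2)
         + replicate_mset (m * (card (group_center G) - 1))
             (of_nat (card (group_center G)) - 2)"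
proof -
  interpret group G by (rule assms(2))
  let ?\<Gamma> = "commuting_graph G" and ?Z = "group_center G"
  obtain x y where "x \<in> carrier G" "y \<in> carrier G"
    "rcosets\<^bsub>G\<^esub> ?Z = (\<lambda>i :: nat. ?Z #>\<^bsub>G\<^esub> x [^]\<^bsub>G\<^esub> i) ` {..<m}
                     \<union> (\<lambda>i :: nat. ?Z #>\<^bsub>G\<^esub> (x [^]\<^bsub>G\<^esub> i \<otimes>\<^bsub>G\<^esub> y)) ` {..<m}"
    "card (rcosets\<^bsub>G\<^esub> ?Z) = 2 * m"
    using dihedral_quotient_cosets[OF assms(1,2,4)] by blast
  from dihedral_quotient_commuting_partition[OF assms(3,1) this]
  obtain C Q where part: "partition_on (carrier G - ?Z) (insert C Q)" and "C \<notin> Q"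
    and card_C: "card C = (m - 1) * card ?Z" and card_Q: "card Q = m"
    and card_B: "\<And>B. B \<in> Q \<Longrightarrow> card B = card ?Z"
    and comm: "\<And>B u v. B \<in> insert C Q \<Longrightarrow> u \<in> B \<Longrightarrow> v \<in> carrier G - ?Z
                 \<Longrightarrow> u \<otimes>\<^bsub>G\<^esub> v = v \<otimes>\<^bsub>G\<^esub> u \<longleftrightarrow> v \<in> B"
    by metis
  interpret cluster_graph ?\<Gamma> "insert C Q"
  proof (rule cluster_graph.intro)
    show "graph ?\<Gamma>" using assms(3) by (rule graph_commuting_graph)
    show "partition_on (verts ?\<Gamma>) (insert C Q)" using part by (simp add: commuting_graph_def)
    show "u \<rightarrow>\<^bsub>?\<Gamma>\<^esub> v \<longleftrightarrow> v \<in> B \<and> u \<noteq> v"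
      if B: "B \<in> insert C Q" "u \<in> B" and v: "v \<in> verts ?\<Gamma>" for B u v
    proof -
      have "u \<in> carrier G - ?Z" using B partition_onD1[OF part] by blast
      then have "u \<rightarrow>\<^bsub>?\<Gamma>\<^esub> v \<longleftrightarrow> u \<otimes>\<^bsub>G\<^esub> v = v \<otimes>\<^bsub>G\<^esub> u \<and> u \<noteq> v"
        using v by (auto simp: commuting_graph_def arcs_ends_def arc_to_ends_def)
      then show ?thesis using comm[OF B] v by (auto simp: commuting_graph_def)
    qed
  qed
  have fin: "finite Q" using finite_partition by simp
  have of_nat_C: "(of_nat (card C) :: complex) = (of_nat m - 1) * of_nat (card ?Z)"
    using assms(1) by (simp add: card_C of_nat_diff)
  \<comment> \<open>One zero comes from \<open>C\<close> and \<open>m\<close> zeros from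
    \<open>Q\<close>; the final simplification merges them. In the unfolding,
    \<open>of_nat_C\<close> must act before \<open>card_C\<close>, so that eigenvalues get the
    complex factor \<open>m - 1\<close> while multiplicities keep the natural-number one.\<close>
  have "L_spec ?\<Gamma> = add_mset 0
        (replicate_mset ((m - 1) * card ?Z - 1) ((of_nat m - 1) * of_nat (card ?Z)))
      + (replicate_mset m 0 + replicate_mset (m * (card ?Z - 1)) (of_nat (card ?Z)))"
    using sum_add_mset_replicate[OF fin card_B, of "\<lambda>_. 0 :: complex" of_nat]
    unfolding L_spec_cluster_graph sum.insert[OF fin \<open>C \<notin> Q\<close>] of_nat_C unfolding card_C card_Q
    by (simp only:)
  moreover have "Q_spec ?\<Gamma> = add_mset (2 * ((of_nat m - 1) * of_nat (card ?Z)) - 2)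
        (replicate_mset ((m - 1) * card ?Z - 1) ((of_nat m - 1) * of_nat (card ?Z) - 2))
      + (replicate_mset m (2 * of_nat (card ?Z) - 2)
         + replicate_mset (m * (card ?Z - 1)) (of_nat (card ?Z) - 2))"
    using sum_add_mset_replicate[OF fin card_B, of "\<lambda>n. 2 * of_nat n - 2 :: complex" "\<lambda>n. of_nat n - 2"]
    unfolding Q_spec_cluster_graph sum.insert[OF fin \<open>C \<notin> Q\<close>] of_nat_C unfolding card_C card_Q
    by (simp only:)
  ultimately show ?thesis by (simp add: mult.assoc)
qed

end
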